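(* Let $\mu_1<0$ be a real constant, let $n\ge 2$ be an integer, and suppose $h\in C^2((0,\infty))\cap C^1([0,\infty))$ satisfies $$2r^2h(r)h_{rr}(r)=(n-1)h(r)(h(r)-1)+rh_r(r)\big(rh_r(r)-(n-1)\big),\qquad h(r)>0,\qquad \forall r>0,$$ together with $h(0)=1$ and $h_r(0)=\mu_1$. Then $$\lim_{r\to\infty}h(r)=0.$$
   Context: Functions are real-valued; $h_r$ and $h_{rr}$ denote the first and second derivatives of $h$ in $r$. $C^1([0,\infty))$ means continuously differentiable up to $r=0$, with $h_r(0)$ the one-sided derivative at $0$. *)

theory Defs
  imports Complex_Main
begin

end

theory Submission
  imports Defs
begin

text \<open>
  In the variable \<open>t = ln r\<close> the equation is autonomous, and \<open>u = sqrt h\<close> turns it into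
  \<open>u'' = u' (1 - m / (2 u\<^sup>2)) + (m / 4) (u - 1 / u)\<close> with \<open>m = n - 1\<close>, whose damping term is an
  exact derivative: \<open>(u' - u - m / (2 u))' = (m / 4) (u - 1 / u)\<close>. At a first critical point of
  \<open>h\<close> we would have \<open>h < 1\<close> and hence \<open>h'' < 0\<close>, which is impossible, so \<open>h\<close> decreases. If its
  limit were positive, \<open>u\<close> and \<open>1 / u\<close> would stay bounded while the right-hand side stays below a
  negative constant, forcing \<open>u' \<rightarrow> -\<infinity>\<close> and contradicting \<open>u > 0\<close>.
\<close>

text \<open>The zeros in \<open>{a..b}\<close> form a compact nonempty set, which has a least
  element. By the intermediate value theorem every point with a nonnegative value has a zero at or
  before it, so the sign cannot change earlier.\<close>

lemma first_zero_after_negative: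
  fixes f :: "real \<Rightarrow> real"
  assumes cont: "continuous_on {a..b} f" and "a \<le> b" and neg: "f a < 0" and nonneg: "f b \<ge> 0"
  obtains s where "a < s" "s \<le> b" "f s = 0" "\<And>x. a \<le> x \<Longrightarrow> x < s \<Longrightarrow> f x < 0"
proof -
  define Z where "Z = {x \<in> {a..b}. f x = 0}"
  have ivt: "\<exists>x\<in>Z. x \<le> c" if c: "a \<le> c" "c \<le> b" "f c \<ge> 0" for c
  proof -
    have "continuous_on {a..c} f"
      by (rule continuous_on_subset[OF cont]) (use that in auto)
    then obtain x where "a \<le> x" "x \<le> c" "f x = 0"
      using IVT'[of f a 0 c] neg c by auto
    then show ?thesis
      using c by (auto simp: Z_def)
  qed
  have "closed (f -` {0} \<inter> {a..b})"
    using continuous_on_closed_vimage[of "{a..b}" f] cont by simp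
  also have "f -` {0} \<inter> {a..b} = Z"
    by (auto simp: Z_def)
  finally have "closed Z" .
  then have "compact ({a..b} \<inter> Z)"
    by (intro compact_Int_closed) auto
  also have "{a..b} \<inter> Z = Z"
    by (auto simp: Z_def)
  finally have "compact Z" .
  moreover have "Z \<noteq> {}"
    using ivt[of b] assms by auto
  ultimately obtain s where s: "s \<in> Z" "\<And>x. x \<in> Z \<Longrightarrow> s \<le> x"
    using compact_attains_inf by metis
  show thesis
  proof
    show "a < s" "s \<le> b" "f s = 0"
      using s(1) neg by (auto simp: Z_def order.order_iff_strict)
    show "f x < 0" if "a \<le> x" "x < s" for x
      using ivt[of x] s that by (force simp: Z_def)
  qed
qed

lemma has_real_derivative_nonpos_le:
  fixes f f' :: "real \<Rightarrow> real"
  assumes "\<And>x. x \<ge> a \<Longrightarrow> (f has_real_derivative f' x) (at x)"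
    and "\<And>x. x \<ge> a \<Longrightarrow> f' x \<le> 0" and "a \<le> x"
  shows "f x \<le> f a"
  using DERIV_nonpos_imp_nonincreasing[of a x f] assms by (meson atLeastAtMost_iff)

text \<open>The sum of \<open>f\<close> and \<open>k * ln x\<close> is nonincreasing, so
  \<open>f\<close> falls at least logarithmically. In the time variable \<open>ln x\<close> the
  hypothesis just bounds the slope by \<open>- k\<close>.\<close>

lemma unbounded_below_of_derivative_le_minus_inverse:
  fixes f f' :: "real \<Rightarrow> real"
  assumes "a > 0" and deriv: "\<And>x. x \<ge> a \<Longrightarrow> (f has_real_derivative f' x) (at x)"
    and le: "\<And>x. x \<ge> a \<Longrightarrow> x * f' x \<le> - k" and "k > 0"
  shows "eventually (\<lambda>x. f x \<le> B) at_top"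
proof -
  have bound: "f x \<le> f a + k * ln a - k * ln x" if "x \<ge> a" for x
  proof -
    have "f x + k * ln x \<le> f a + k * ln a"
    proof (rule has_real_derivative_nonpos_le[OF _ _ that])
      fix y assume y: "y \<ge> a"
      show "((\<lambda>x. f x + k * ln x) has_real_derivative (f' y + k / y)) (at y)"
        using y \<open>a > 0\<close> by (auto intro!: derivative_eq_intros deriv)
      show "f' y + k / y \<le> 0"
        using le[OF y] y \<open>a > 0\<close> by (simp add: field_simps)
    qed
    then show ?thesis by simp
  qed
  have "eventually (\<lambda>x. ln x \<ge> (f a + k * ln a - B) / k) at_top"
    using ln_at_top by (simp add: filterlim_at_top)
  with eventually_ge_at_top[of a] show ?thesis
  proof eventually_elim
    case (elim x)
    then show ?case
      using bound[of x] \<open>k > 0\<close> by (simp add: field_simps)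
  qed
qed

text \<open>Taking the first zero \<open>s\<close> of \<open>h'\<close> pays off twice:
  \<open>h' < 0\<close> before \<open>s\<close> gives \<open>h s < 1\<close>, and it rules out
  \<open>h'' s < 0\<close>, which would make \<open>h'\<close> positive just to the left of
  \<open>s\<close>.\<close>

lemma ode_derivative_neg:
  fixes h h' h'' :: "real \<Rightarrow> real" and m :: real
  assumes m: "m > 0"
    and h_deriv: "\<And>r. r \<ge> 0 \<Longrightarrow> (h has_real_derivative h' r) (at r within {0..})"
    and h'_cont: "continuous_on {0..} h'"
    and h'_deriv: "\<And>r. r > 0 \<Longrightarrow> (h' has_real_derivative h'' r) (at r)"
    and ode: "\<And>r. r > 0 \<Longrightarrow>
      2 * r\<^sup>2 * h r * h'' r = m * h r * (h r - 1) + r * h' r * (r * h' r - m)"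
    and h_pos: "\<And>r. r > 0 \<Longrightarrow> h r > 0"
    and h_0: "h 0 = 1" and h'_0: "h' 0 < 0" and "r \<ge> 0"
  shows "h' r < 0"
proof (rule ccontr)
  assume "\<not> h' r < 0"
  moreover have "continuous_on {0..r} h'"
    by (rule continuous_on_subset[OF h'_cont]) auto
  ultimately obtain s where s: "0 < s" "h' s = 0" and neg: "\<And>x. 0 \<le> x \<Longrightarrow> x < s \<Longrightarrow> h' x < 0"
    using first_zero_after_negative[of 0 r h'] h'_0 \<open>r \<ge> 0\<close> by (auto simp: not_less)
  have deriv_at: "(h has_real_derivative h' x) (at x)" if "x > 0" for x
    using h_deriv[of x] at_within_open_subset[of x "{0<..}" "{0..}"] that by (simp add: Ioi_le_Ico)
  have "continuous_on {0..s} h"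
    by (rule continuous_on_subset[of "{0..}"])
      (auto intro!: DERIV_continuous_on h_deriv)
  then have "h s < h 0"
    using deriv_at neg s by (intro DERIV_neg_imp_decreasing_open[of 0 s h]) force+
  then have "m * h s * (h s - 1) < 0"
    using m h_pos[OF s(1)] h_0 by (simp add: mult_pos_neg)
  then have "2 * s\<^sup>2 * h s * h'' s < 0"
    using ode[OF s(1)] unfolding s(2) by linarith
  then have "h'' s < 0"
    using h_pos[OF s(1)] s by (simp add: mult_less_0_iff zero_less_mult_iff)
  then obtain d where d: "d > 0" "\<And>e. 0 < e \<Longrightarrow> e < d \<Longrightarrow> h' s < h' (s - e)"
    using DERIV_neg_dec_left[OF h'_deriv[OF s(1)]] by blast
  \<comment> \<open>Halving both bounds keeps \<open>s - e\<close> inside the interval where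
    \<open>h'\<close> is known to be negative.\<close>
  define e where "e = min (d / 2) (s / 2)"
  have "0 < e" "e < d" "e < s"
    using d(1) s(1) by (auto simp: e_def min_def)
  with d(2)[of e] neg[of "s - e"] s show False
    by simp
qed

text \<open>This is the exact-derivative identity for \<open>u = sqrt h\<close>, written in
  \<open>r\<close>: the derivative in \<open>ln r\<close> is \<open>r\<close> times the derivative
  in \<open>r\<close>, which accounts for the leading factor \<open>r\<close> and for the
  \<open>r\<close> in the denominator.\<close>

lemma ode_first_integral_derivative:
  fixes h h' h'' :: "real \<Rightarrow> real" and m :: real
  assumes r: "r > 0" and pos: "h r > 0"
    and h: "(h has_real_derivative h' r) (at r)"
    and h': "(h' has_real_derivative h'' r) (at r)"
    and ode: "2 * r\<^sup>2 * h r * h'' r = m * h r * (h r - 1) + r * h' r * (r * h' r - m)"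
  shows "((\<lambda>r. r * (h' r / (2 * sqrt (h r))) - sqrt (h r) - m / (2 * sqrt (h r)))
    has_real_derivative m * (h r - 1) / (4 * r * sqrt (h r))) (at r)"
proof -
  \<comment> \<open>\<open>v\<close> is the function to differentiate and \<open>u\<close> its value
    at the fixed point \<open>r\<close>; with \<open>h r = u\<^sup>2\<close> the remaining algebra
    is rational in \<open>u\<close>.\<close>
  define v where "v = (\<lambda>r. sqrt (h r))"
  define u where "u = v r"
  have u: "u > 0" and hu: "h r = u\<^sup>2"
    using pos by (auto simp: u_def v_def)
  have v: "(v has_real_derivative h' r / (2 * u)) (at r)"
    using DERIV_chain2[OF DERIV_real_sqrt[OF pos] h] by (simp add: u_def v_def field_simps)
  have "((\<lambda>r. r * (h' r / (2 * v r)) - v r - m / (2 * v r)) has_real_derivative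
      (h' r / (2 * u) + r * ((h'' r * (2 * u) - h' r * (h' r / u)) / (2 * u)\<^sup>2)
        - h' r / (2 * u) + m * (h' r / u) / (2 * u)\<^sup>2)) (at r)"
  proof (rule DERIV_cong)
    show "((\<lambda>r. r * (h' r / (2 * v r)) - v r - m / (2 * v r)) has_real_derivative
        (r * ((h'' r * (2 * u) - h' r * (2 * (h' r / (2 * u)))) / (2 * u * (2 * u)))
          + 1 * (h' r / (2 * u))) - h' r / (2 * u)
          - (0 * (2 * u) - m * (2 * (h' r / (2 * u)))) / (2 * u * (2 * u))) (at r)"
      using u unfolding u_def
      by (intro DERIV_diff DERIV_mult' DERIV_divide DERIV_ident DERIV_cmult DERIV_const h'
          v[unfolded u_def]) auto
  qed (use u in \<open>simp add: power2_eq_square\<close>)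
  \<comment> \<open>Once the equation is solved for \<open>h'' r\<close>, its terms quadratic and
    linear in \<open>h' r\<close> cancel the other two contributions, leaving only the term with
    \<open>u\<^sup>2 - 1\<close>.\<close>
  moreover have h'': "h'' r = (m * u\<^sup>2 * (u\<^sup>2 - 1) + r * h' r * (r * h' r - m)) / (2 * r\<^sup>2 * u\<^sup>2)"
    using ode u r by (simp add: hu field_simps)
  have "h' r / (2 * u) + r * ((h'' r * (2 * u) - h' r * (h' r / u)) / (2 * u)\<^sup>2)
        - h' r / (2 * u) + m * (h' r / u) / (2 * u)\<^sup>2 = m * (u\<^sup>2 - 1) / (4 * r * u)"
    unfolding h'' using u r by (simp add: field_simps power2_eq_square)
  ultimately show ?thesis
    using pos by (simp add: u_def v_def)
qed

theorem theorem1p5: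
  fixes \<mu>\<^sub>1 :: real and n :: nat and h h\<^sub>r h\<^sub>r\<^sub>r :: "real \<Rightarrow> real"
  assumes mu: "\<mu>\<^sub>1 < 0"
    and n: "n \<ge> 2"
    and h_deriv: "\<And>r. r \<ge> 0 \<Longrightarrow> (h has_real_derivative h\<^sub>r r) (at r within {0..})"
    and hr_cont: "continuous_on {0..} h\<^sub>r"
    and hr_deriv: "\<And>r. r > 0 \<Longrightarrow> (h\<^sub>r has_real_derivative h\<^sub>r\<^sub>r r) (at r)"
    and hrr_cont: "continuous_on {0<..} h\<^sub>r\<^sub>r"
    and ode: "\<And>r. r > 0 \<Longrightarrow>
      2 * r\<^sup>2 * h r * h\<^sub>r\<^sub>r r =
        (real n - 1) * h r * (h r - 1) + r * h\<^sub>r r * (r * h\<^sub>r r - (real n - 1))"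
    and h_pos: "\<And>r. r > 0 \<Longrightarrow> h r > 0"
    and h_0: "h 0 = 1"
    and hr_0: "h\<^sub>r 0 = \<mu>\<^sub>1"
  shows "(h \<longlongrightarrow> 0) at_top"
proof -
  define m where "m = real n - 1"
  have m: "m > 0"
    using n by (simp add: m_def)
  have hr_neg: "h\<^sub>r r < 0" if "r \<ge> 0" for r
    by (rule ode_derivative_neg[OF m h_deriv hr_cont hr_deriv _ h_pos h_0])
      (use ode mu hr_0 that in \<open>simp_all add: m_def\<close>)
  have deriv_at: "(h has_real_derivative h\<^sub>r x) (at x)" if "x > 0" for x
    using h_deriv[of x] at_within_open_subset[of x "{0<..}" "{0..}"] that by (simp add: Ioi_le_Ico)
  have cont: "continuous_on {0..} h"
    by (auto intro!: DERIV_continuous_on h_deriv)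
  have decr: "h y < h x" if "0 \<le> x" "x < y" for x y
  proof (rule DERIV_neg_imp_decreasing_open[OF that(2)])
    show "continuous_on {x..y} h"
      by (rule continuous_on_subset[OF cont]) (use that in auto)
  qed (use deriv_at hr_neg that in force)
  show ?thesis
  proof (rule ccontr)
    assume not_lim: "\<not> (h \<longlongrightarrow> 0) at_top"
    \<comment> \<open>Since \<open>h\<close> is positive and decreasing, a single value below
      \<open>e\<close> keeps all later values below \<open>e\<close>; hence failure to tend to 0
      gives a positive lower bound.\<close>
    have "\<exists>l>0. \<forall>r>0. h r \<ge> l"
    proof (rule ccontr)
      assume no_bound: "\<not> (\<exists>l>0. \<forall>r>0. h r \<ge> l)"
      have "(h \<longlongrightarrow> 0) at_top"
      proof (rule tendstoI)
        fix e :: real assume "e > 0"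
        then obtain r where r: "r > 0" "h r < e"
          using no_bound by (meson not_le)
        show "eventually (\<lambda>x. dist (h x) 0 < e) at_top"
          using eventually_gt_at_top[of r]
        proof eventually_elim
          case (elim x)
          then show ?case
            using decr[of r x] h_pos[of x] r by (simp add: dist_real_def)
        qed
      qed
      with not_lim show False by blast
    qed
    then obtain l where l: "l > 0" "\<And>r. r > 0 \<Longrightarrow> h r \<ge> l"
      by blast
    define u where "u = (\<lambda>r. sqrt (h r))"
    define u' where "u' = (\<lambda>r. h\<^sub>r r / (2 * u r))"
    define Q where "Q = (\<lambda>r. r * u' r - u r - m / (2 * u r))"
    \<comment> \<open>For \<open>r \<ge> 1\<close> monotonicity gives
      \<open>1 - h r \<ge> 1 - h 1\<close>, and \<open>u r \<le> 1\<close> gives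
      \<open>1 / u r \<ge> 1\<close>; so \<open>r\<close> times the derivative of \<open>Q\<close>
      is at most \<open>- k\<close>.\<close>
    define k where "k = m * (1 - h 1) / 4"
    have k: "k > 0"
      using decr[of 0 1] h_0 m by (simp add: k_def)
    have u_pos: "u r > 0" and u_le: "u r \<le> 1" and u_ge: "sqrt l \<le> u r" if "r > 0" for r
      using h_pos[OF that] decr[of 0 r] l(2)[OF that] h_0 that by (auto simp: u_def)
    have u_deriv: "(u has_real_derivative u' r) (at r)" if "r > 0" for r
      using DERIV_chain2[OF DERIV_real_sqrt[OF h_pos[OF that]] deriv_at[OF that]]
      by (simp add: u_def u'_def field_simps)
    have Q_deriv: "(Q has_real_derivative m * (h r - 1) / (4 * r * u r)) (at r)" if "r > 0" for r
      using ode_first_integral_derivative[where h = h and h' = h\<^sub>r and h'' = h\<^sub>r\<^sub>r and m = m and r = r]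
        h_pos deriv_at hr_deriv ode that
      by (simp add: Q_def u_def u'_def m_def)
    \<comment> \<open>The threshold absorbs \<open>u r \<le> 1\<close> and
      \<open>m / (2 * u r) \<le> m / (2 * sqrt l)\<close>, so that exactly
      \<open>r * u' r \<le> - 1\<close> remains.\<close>
    have "eventually (\<lambda>r. Q r \<le> - 2 - m / (2 * sqrt l)) at_top"
    proof (rule unbounded_below_of_derivative_le_minus_inverse[OF _ Q_deriv _ k])
      fix r :: real assume r: "r \<ge> 1"
      have "h r \<le> h 1"
        using decr[of 1 r] r by (cases "r = 1") auto
      then have "1 - h 1 \<le> (1 - h r) * 1"
        by simp
      also have "\<dots> \<le> (1 - h r) * (1 / u r)"
        using decr[of 0 r] h_0 u_pos[of r] u_le[of r] r by (intro mult_left_mono) auto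
      finally have "m * (1 - h 1) \<le> m * ((1 - h r) * (1 / u r))"
        using m by (intro mult_left_mono) auto
      moreover have "r * (m * (h r - 1) / (4 * r * u r)) = - (m * ((1 - h r) * (1 / u r))) / 4"
        using r u_pos[of r] by (simp add: field_simps)
      ultimately show "r * (m * (h r - 1) / (4 * r * u r)) \<le> - k"
        by (simp add: k_def)
    qed auto
    then have "eventually (\<lambda>r. r * u' r \<le> - 1) at_top"
      using eventually_gt_at_top[of 0]
    proof eventually_elim
      case (elim r)
      have "m / (2 * u r) \<le> m / (2 * sqrt l)"
        using u_ge[of r] u_pos[of r] elim l(1) m by (intro divide_left_mono) auto
      then show ?case
        using elim u_le[of r] by (simp add: Q_def)
    qed
    then obtain R where R: "\<And>r. r \<ge> R \<Longrightarrow> r * u' r \<le> - 1"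
      by (auto simp: eventually_at_top_linorder)
    \<comment> \<open>The same logarithmic decay, now for \<open>u\<close> itself with rate 1,
      contradicts \<open>u > 0\<close>. The maximum with 1 makes the starting point
      positive.\<close>
    have "eventually (\<lambda>r. u r \<le> 0) at_top"
      by (rule unbounded_below_of_derivative_le_minus_inverse[of "max R 1" u u' 1])
        (use R u_deriv in auto)
    then have "eventually (\<lambda>r::real. False) at_top"
      using eventually_gt_at_top[of 0]
    proof eventually_elim
      case (elim r)
      then show ?case
        using u_pos[of r] by simp
    qed
    then show False
      by simp
  qed
qed

end
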